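(* Let $n=p^m$ where $p$ is a prime and $m>1$ is an integer. Then the Laplacian eigenvalues of the comaximal graph $\Gamma(\mathbb{Z}_n)$ are $n$ with multiplicity $\phi(n)$, $\phi(n)$ with multiplicity $n-\phi(n)-1$, and $0$ with multiplicity $1$.
   Context: The comaximal graph $\Gamma(\mathbb{Z}_n)$ has vertex set $\mathbb{Z}_n=\{0,1,\dots,n-1\}$, distinct $x,y$ adjacent iff $\langle x\rangle+\langle y\rangle=\mathbb{Z}_n$. Its Laplacian matrix is $L=D-A$ ($D$ diagonal degree matrix, $A$ adjacency matrix). $\phi$ is Euler's totient function. *)

theory Defs
  imports
    "Jordan_Normal_Form.Spectral_Radius"
    "Graph_Theory.Pair_Digraph"
    "HOL-Number_Theory.Residues"
    "HOL-Number_Theory.Totient"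
begin

text \<open>
  An undirected simple graph is represented, as usual in the theory \<open>Pair_Digraph\<close>, by a symmetric loop-free
  digraph without parallel arcs. The ring of integers modulo \<open>n\<close> has carrier \<open>{0..n - 1}\<close>.
\<close>

definition comaximal_graph :: "nat \<Rightarrow> int pair_pre_digraph" where
  "comaximal_graph n =
     (let R = residue_ring (int n) in
      \<lparr> pverts = carrier R,
        parcs = {(x, y). x \<in> carrier R \<and> y \<in> carrier R \<and> x \<noteq> y \<and>
                         (PIdl\<^bsub>R\<^esub> x) <+>\<^bsub>R\<^esub> (PIdl\<^bsub>R\<^esub> y) = carrier R} \<rparr>)"

lemma pair_graph_comaximal_graph: "pair_graph (comaximal_graph n)"
proof -
  let ?R = "residue_ring (int n)"
  have comm: "A <+>\<^bsub>?R\<^esub> B = B <+>\<^bsub>?R\<^esub> A" for A B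
  proof -
    have "x \<oplus>\<^bsub>?R\<^esub> y = y \<oplus>\<^bsub>?R\<^esub> x" for x y
      by (simp add: residue_ring_def add.commute)
    then show ?thesis
      unfolding set_add_def' by blast
  qed
  have pverts: "pverts (comaximal_graph n) = carrier ?R"
    by (simp add: comaximal_graph_def Let_def)
  have parcs: "(x, y) \<in> parcs (comaximal_graph n) \<longleftrightarrow>
      x \<in> carrier ?R \<and> y \<in> carrier ?R \<and> x \<noteq> y \<and>
      (PIdl\<^bsub>?R\<^esub> x) <+>\<^bsub>?R\<^esub> (PIdl\<^bsub>?R\<^esub> y) = carrier ?R" for x y
    by (simp add: comaximal_graph_def Let_def)
  have fin: "finite (carrier ?R)"
    by (simp add: residue_ring_def)
  have sub: "parcs (comaximal_graph n) \<subseteq> carrier ?R \<times> carrier ?R"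
    by (auto simp only: parcs mem_Times_iff fst_conv snd_conv)
  show ?thesis
  proof
    show "fst e \<in> pverts (comaximal_graph n)" if "e \<in> parcs (comaximal_graph n)" for e
      using subsetD[OF sub that] by (simp only: pverts mem_Times_iff)
    show "snd e \<in> pverts (comaximal_graph n)" if "e \<in> parcs (comaximal_graph n)" for e
      using subsetD[OF sub that] by (simp only: pverts mem_Times_iff)
    show "finite (pverts (comaximal_graph n))"
      by (simp only: pverts fin)
    show "finite (parcs (comaximal_graph n))"
      using finite_subset[OF sub finite_cartesian_product[OF fin fin]] .
    show "fst e \<noteq> snd e" if "e \<in> parcs (comaximal_graph n)" for e
      using that parcs[of "fst e" "snd e"] by (simp only: prod.collapse simp_thms)
    show "symmetric (with_proj (comaximal_graph n))"
      unfolding symmetric_def with_proj_simps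
    proof (rule symI)
      fix x y
      assume "(x, y) \<in> parcs (comaximal_graph n)"
      then show "(y, x) \<in> parcs (comaximal_graph n)"
        unfolding parcs using comm[of "PIdl\<^bsub>?R\<^esub> x" "PIdl\<^bsub>?R\<^esub> y"] by metis
    qed
  qed
qed

text \<open>
  Matrices of a graph whose vertices are the integers \<open>0, \<dots>, N - 1\<close>: row and column
  \<open>i\<close> belong to the vertex \<open>int i\<close>. In a symmetric digraph, the degree of a vertex is its
  out-degree.
\<close>

definition adjacency_matrix :: "int pair_pre_digraph \<Rightarrow> real mat" where
  "adjacency_matrix G = mat (card (pverts G)) (card (pverts G))
     (\<lambda>(i, j). if (int i, int j) \<in> parcs G then 1 else 0)"

definition degree_matrix :: "int pair_pre_digraph \<Rightarrow> real mat" where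
  "degree_matrix G = mat_diag (card (pverts G)) (\<lambda>i. real (out_degree (with_proj G) (int i)))"

definition laplacian_matrix :: "int pair_pre_digraph \<Rightarrow> real mat" where
  "laplacian_matrix G = degree_matrix G - adjacency_matrix G"

text \<open>
  Algebraic multiplicity; for the symmetric matrices at hand it agrees with the geometric one.
\<close>

definition eigenvalue_mult :: "real mat \<Rightarrow> real \<Rightarrow> nat" where
  "eigenvalue_mult A x = Polynomial.order x (char_poly A)"

end

theory Submission
  imports Defs
begin

text \<open>
  For \<open>n = p\<^sup>m\<close> two distinct vertices are adjacent iff one of them is a unit, so the graph is the join of
  the complete graph on the units and the edgeless graph on the non-units. Its Laplacian kills the
  all-ones vector, maps \<open>e\<^sub>u\<close> to \<open>n e\<^sub>u\<close> minus the all-ones vector for a unit \<open>u\<close>, and has the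
  eigenvectors \<open>e\<^sub>j - e\<^sub>0\<close> with eigenvalue \<open>\<phi>(n)\<close> for the non-units \<open>j \<noteq> 0\<close>. In this basis it is
  upper triangular, and the multiplicities are read off its diagonal.
\<close>

section \<open>Linear algebra: triangularising the Laplacian of a complete split graph\<close>

text \<open>The characteristic polynomial is a product of linear factors, one per diagonal entry,
  and the order at \<open>x\<close> is additive over such a product.\<close>

lemma order_char_poly_upper_triangular:
  fixes A :: "'a :: field mat"
  assumes "A \<in> carrier_mat n n" and "upper_triangular A"
  shows "Polynomial.order x (char_poly A) = card {i. i < n \<and> A $$ (i, i) = x}"
proof -
  have "Polynomial.order x (char_poly A) = (\<Sum>a\<leftarrow>diag_mat A. if a = x then 1 else 0)"
    unfolding char_poly_upper_triangular[OF assms]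
    by (subst order_prod_list)
      (auto simp: o_def order_linear' intro!: arg_cong[where f = sum_list])
  also have "\<dots> = (\<Sum>i<n. if A $$ (i, i) = x then 1 else 0)"
    using assms(1) by (simp add: diag_mat_def o_def interv_sum_list_conv_sum_set_nat atLeast0LessThan)
  also have "\<dots> = card {i. i < n \<and> A $$ (i, i) = x}"
    by (simp add: sum.If_cases Int_def)
  finally show ?thesis .
qed

text \<open>\<open>L\<close> is the Laplacian of the join of a complete graph on \<open>U\<close>
  and an edgeless graph on the rest. The subtracted term also hits the diagonal at \<open>i\<close>
  in \<open>U\<close>, so \<open>d i\<close> is there the degree plus one. Index 0 lies outside
  \<open>U\<close> and serves as the slot of the all-ones vector, hence the eigenvalue 0 in that
  place.\<close>

lemma order_char_poly_complete_split_laplacian: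
  fixes n :: nat and U :: "nat set" and x :: real
  assumes U: "U \<subseteq> {0<..<n}" and n: "0 < n"
  defines "d \<equiv> \<lambda>i. real (if i \<in> U then n else card U)"
  defines "L \<equiv> mat n n (\<lambda>(i, j). (if i = j then d i else 0) - (if i \<in> U \<or> j \<in> U then 1 else 0))"
  shows "Polynomial.order x (char_poly L) =
           card {i. i < n \<and> (if i = 0 then 0 else d i) = x}"
proof -
  \<comment> \<open>The number of indices outside \<open>U\<close>, 0 included. The all-ones vector
    is \<open>r\<close> times e_0 plus all the other basis vectors chosen below, so solving for e_0
    produces the factor 1 / \<open>r\<close> in \<open>Q\<close>.\<close>
  define r where "r = real (n - card U)"
  \<comment> \<open>The columns of \<open>P\<close> are the all-ones vector, then \<open>e\<^sub>j\<close> for \<open>j \<in> U\<close> and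
    \<open>e\<^sub>j - e\<^sub>0\<close> otherwise; \<open>Q\<close> is the inverse of \<open>P\<close>.\<close>
  define P where "P = mat n n (\<lambda>(i, j). if j = 0 then 1 else
    (if i = j then 1 else 0) - (if i = 0 then if j \<in> U then 0 else 1 else 0) :: real)"
  define Q where "Q = mat n n (\<lambda>(i, j).
    (if i = j then if i = 0 then 0 else 1 else 0) +
    (if j \<in> U then 0 else if i = 0 then 1 / r else - 1 / r) :: real)"
  \<comment> \<open>The matrix of \<open>L\<close> in the new basis: for \<open>j\<close> in
    \<open>U\<close> the all-ones vector subtracted from n e_j appears as the entry -1 in row
    0.\<close>
  define T where "T = mat n n (\<lambda>(i, j).
    (if i = j then if j = 0 then 0 else d j else 0) - (if i = 0 then if j \<in> U then 1 else 0 else 0))"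
  have fin: "finite U" and sub: "U \<subseteq> {0..<n}" and U0: "0 \<notin> U"
    using U finite_subset by auto
  have less: "card U < n"
    using card_mono[OF _ U] n by simp
  hence r: "r > 0" "r = real n - real (card U)"
    by (auto simp: r_def)
  have cU: "{0..<n} \<inter> U = U" and cN: "real (card ({0..<n} \<inter> - U)) = r"
    using sub card_Diff_subset[OF fin sub] by (auto simp: r_def Diff_eq)
  have sum_U: "(\<Sum>k = 0..<n. if k \<in> U then a else b) = real (card U) * a + r * b" for a b :: real
    by (simp add: sum.If_cases cU cN Collect_mem_eq)
  have dims: "P \<in> carrier_mat n n" "Q \<in> carrier_mat n n" "T \<in> carrier_mat n n" "L \<in> carrier_mat n n"
    by (auto simp: P_def Q_def T_def L_def)
  \<comment> \<open>The next three facts multiply an arbitrary row \<open>a\<close> by a column,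
    which reduces the matrix identities to case distinctions. The term \<open>2 * a 0\<close> arises
    because the entry 1 / \<open>r\<close> in row 0 of \<open>Q\<close> has the sign opposite to the
    other rows.\<close>
  have sum_Q: "(\<Sum>k = 0..<n. a k * Q $$ (k, j)) =
      (if j = 0 then 0 else a j) + (if j \<in> U then 0 else (2 * a 0 - (\<Sum>k = 0..<n. a k)) / r)"
    if "j < n" for a :: "nat \<Rightarrow> real" and j
  proof -
    have "(\<Sum>k = 0..<n. a k * Q $$ (k, j)) =
      (\<Sum>k = 0..<n. (if k = j then if j = 0 then 0 else a j else 0) +
        (if j \<in> U then 0 else (if k = 0 then 2 * a 0 / r else 0) - a k / r))"
      using that r(1) by (intro sum.cong) (auto simp: Q_def field_simps)
    also have "\<dots> = (if j = 0 then 0 else a j) +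
       (if j \<in> U then 0 else (2 * a 0 - (\<Sum>k = 0..<n. a k)) / r)"
      using that n
      by (simp add: sum.distrib sum_subtractf sum_divide_distrib diff_divide_distrib)
    finally show ?thesis .
  qed
  have sum_P: "(\<Sum>k = 0..<n. a k * P $$ (k, j)) =
      (if j = 0 then \<Sum>k = 0..<n. a k else a j - (if j \<in> U then 0 else a 0))"
    if "j < n" for a :: "nat \<Rightarrow> real" and j
  proof (cases "j = 0")
    case False
    have "(\<Sum>k = 0..<n. a k * P $$ (k, j)) =
      (\<Sum>k = 0..<n. (if k = j then a j else 0) - (if k = 0 then if j \<in> U then 0 else a 0 else 0))"
      using that False by (intro sum.cong) (auto simp: P_def)
    then show ?thesis
      using that n False by (simp add: sum_subtractf)
  qed (use that in \<open>simp add: P_def\<close>)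
  have sum_T: "(\<Sum>k = 0..<n. a k * T $$ (k, j)) =
      (if j = 0 then 0 else a j * d j) - (if j \<in> U then a 0 else 0)"
    if "j < n" for a :: "nat \<Rightarrow> real" and j
  proof -
    have "(\<Sum>k = 0..<n. a k * T $$ (k, j)) =
      (\<Sum>k = 0..<n. (if k = j then if j = 0 then 0 else a j * d j else 0) -
         (if k = 0 then if j \<in> U then a 0 else 0 else 0))"
      using that by (intro sum.cong) (auto simp: T_def)
    then show ?thesis
      using that n by (simp add: sum_subtractf)
  qed
  \<comment> \<open>These row sums feed \<open>sum_Q\<close>: for \<open>j\<close> outside
    \<open>U\<close>, twice the entry 1 in column 0 minus the row sum is \<open>r\<close> in row 0
    and 0 elsewhere.\<close>
  have row_P: "(\<Sum>k = 0..<n. P $$ (i, k)) = (if i = 0 then 2 - r else 2)" if i: "i < n" for i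
  proof -
    have "(\<Sum>k = 0..<n. P $$ (i, k)) =
      (\<Sum>k = 0..<n. (if k = 0 then 1 else 0) + (if k = i then 1 else 0) -
         (if i = 0 then if k \<in> U then 0 else 1 else 0))"
      using i U0 by (intro sum.cong) (auto simp: P_def)
    also have "\<dots> = (if i = 0 then 2 - r else 2)"
      using i n by (simp add: sum.distrib sum_subtractf sum_U)
    finally show ?thesis .
  qed
  \<comment> \<open>The all-ones vector is in the kernel of \<open>L\<close>; this settles column 0
    of \<open>L * P\<close>.\<close>
  have row_L: "(\<Sum>k = 0..<n. L $$ (i, k)) = 0" if i: "i < n" for i
  proof -
    have "(\<Sum>k = 0..<n. L $$ (i, k)) =
      (\<Sum>k = 0..<n. (if k = i then d i else 0) - (if k \<in> U then 1 else if i \<in> U then 1 else 0))"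
      using i by (intro sum.cong) (auto simp: L_def)
    also have "\<dots> = 0"
      using i r by (simp add: sum_subtractf sum_U d_def)
    finally show ?thesis .
  qed
  have PQ: "P * Q = 1\<^sub>m n"
  proof (rule eq_matI)
    fix i j assume ij: "i < dim_row (1\<^sub>m n)" "j < dim_col (1\<^sub>m n)"
    then have "(P * Q) $$ (i, j) = (\<Sum>k = 0..<n. P $$ (i, k) * Q $$ (k, j))"
      using dims by (simp add: scalar_prod_def)
    then show "(P * Q) $$ (i, j) = 1\<^sub>m n $$ (i, j)"
      using ij r(1) U0 n by (auto simp: sum_Q row_P) (auto simp: P_def)
  qed (use dims in auto)
  have LP: "L * P = P * T"
  proof (rule eq_matI)
    fix i j assume ij: "i < dim_row (P * T)" "j < dim_col (P * T)"
    then have "(L * P) $$ (i, j) = (\<Sum>k = 0..<n. L $$ (i, k) * P $$ (k, j))"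
      and "(P * T) $$ (i, j) = (\<Sum>k = 0..<n. P $$ (i, k) * T $$ (k, j))"
      using dims by (simp_all add: scalar_prod_def)
    then show "(L * P) $$ (i, j) = (P * T) $$ (i, j)"
      using ij dims U0 n by (auto simp: sum_P sum_T row_L) (auto simp: L_def P_def d_def)
  qed (use dims in auto)
  have QP: "Q * P = 1\<^sub>m n"
    using mat_mult_left_right_inverse[OF dims(1,2) PQ] .
  have "L = L * (P * Q)"
    using dims by (simp add: PQ)
  also have "\<dots> = P * T * Q"
    using dims by (simp flip: LP add: assoc_mult_mat[of _ n n _ n _ n])
  finally have "similar_mat L T"
    by (intro similar_matI[of _ _ P Q n] PQ QP) (use dims in auto)
  then have "char_poly L = char_poly T"
    by (rule char_poly_similar)
  moreover have "upper_triangular T"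
    by (auto simp: upper_triangular_def T_def)
  moreover have "{i. i < n \<and> T $$ (i, i) = x} = {i. i < n \<and> (if i = 0 then 0 else d i) = x}"
    using U0 by (auto simp: T_def)
  ultimately show ?thesis
    using order_char_poly_upper_triangular[OF dims(3)] by simp
qed

section \<open>Adjacency and degrees modulo a prime power\<close>

text \<open>The residue ring modulo a prime power is local: a unit generates the whole ring, while
  the non-units are the multiples of \<open>p\<close>, which are closed under linear combinations
  and so never reach 1.\<close>

lemma principal_ideals_sum_carrier_iff:
  fixes p m :: nat and x y :: int
  assumes p: "prime p" and m: "0 < m"
  defines "R \<equiv> residue_ring (int (p ^ m))"
  shows "(PIdl\<^bsub>R\<^esub> x) <+>\<^bsub>R\<^esub> (PIdl\<^bsub>R\<^esub> y) = carrier R \<longleftrightarrow>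
         coprime x (int (p ^ m)) \<or> coprime y (int (p ^ m))"
proof -
  define N where "N = int (p ^ m)"
  have N1: "N > 1"
    using one_less_power[OF prime_gt_1_nat[OF p] m] unfolding N_def by linarith
  have pN: "int p dvd N"
    using m by (simp add: N_def dvd_power)
  have coprime_iff: "coprime z N \<longleftrightarrow> \<not> int p dvd z" for z
  proof -
    have "coprime z N \<longleftrightarrow> coprime (int p) z"
      using m by (simp add: N_def coprime_commute)
    also have "\<dots> \<longleftrightarrow> \<not> int p dvd z"
      using p by (metis coprime_absorb_left not_prime_unit prime_imp_coprime prime_nat_int_transfer)
    finally show ?thesis .
  qed
  have elem: "z \<in> (PIdl\<^bsub>R\<^esub> x) <+>\<^bsub>R\<^esub> (PIdl\<^bsub>R\<^esub> y) \<longleftrightarrow>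
      (\<exists>a\<in>{0..N - 1}. \<exists>b\<in>{0..N - 1}. z = (a * x + b * y) mod N)" for x y z
  proof -
    have "z \<in> (PIdl\<^bsub>R\<^esub> x) <+>\<^bsub>R\<^esub> (PIdl\<^bsub>R\<^esub> y) \<longleftrightarrow>
        (\<exists>a\<in>{0..N - 1}. \<exists>b\<in>{0..N - 1}. z = (a * x mod N + b * y mod N) mod N)"
      unfolding R_def set_add_def' cgenideal_def residue_ring_def N_def[symmetric]
      by (simp del: atLeastAtMost_iff) blast
    then show ?thesis by (simp only: mod_add_eq)
  qed
  have carr: "carrier R = {0..N - 1}"
    by (simp add: R_def residue_ring_def N_def)
  have sub: "(PIdl\<^bsub>R\<^esub> x) <+>\<^bsub>R\<^esub> (PIdl\<^bsub>R\<^esub> y) \<subseteq> carrier R" for x y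
    using N1 by (auto simp: elem carr)
  have swap: "(PIdl\<^bsub>R\<^esub> x) <+>\<^bsub>R\<^esub> (PIdl\<^bsub>R\<^esub> y) = (PIdl\<^bsub>R\<^esub> y) <+>\<^bsub>R\<^esub> (PIdl\<^bsub>R\<^esub> x)" for x y
    unfolding set_eq_iff elem by (metis add.commute)
  have unit: "(PIdl\<^bsub>R\<^esub> x) <+>\<^bsub>R\<^esub> (PIdl\<^bsub>R\<^esub> y) = carrier R" if cop: "coprime x N" for x y
  proof -
    obtain t where "[x * t = 1] (mod N)"
      using cong_solve_coprime_int[OF cop] by blast
    then have t: "[z * (x * t) = z * 1] (mod N)" for z
      by (rule cong_scalar_left)
    \<comment> \<open>Since \<open>t\<close> inverts \<open>x\<close> modulo \<open>N\<close>, the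
      ideal of \<open>x\<close> alone already contains \<open>z\<close>; the coefficient is reduced
      modulo \<open>N\<close> to lie in the carrier.\<close>
    have "z = (((z * t) mod N) * x + 0 * y) mod N" if "z \<in> carrier R" for z
    proof -
      have "(((z * t) mod N) * x + 0 * y) mod N = (z * (x * t)) mod N"
        by (metis add_0_right mult.assoc mult.commute mult_zero_left mod_mult_left_eq)
      then show ?thesis
        using t[of z] that by (simp add: carr cong_def)
    qed
    moreover have "(z * t) mod N \<in> {0..N - 1}" "0 \<in> {0..N - 1}" for z
      using N1 by auto
    ultimately have "carrier R \<subseteq> (PIdl\<^bsub>R\<^esub> x) <+>\<^bsub>R\<^esub> (PIdl\<^bsub>R\<^esub> y)"
      unfolding subset_eq elem by blast
    with sub show ?thesis by blast
  qed
  have "coprime x N \<or> coprime y N" if eq: "(PIdl\<^bsub>R\<^esub> x) <+>\<^bsub>R\<^esub> (PIdl\<^bsub>R\<^esub> y) = carrier R"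
  proof (rule ccontr)
    assume "\<not> (coprime x N \<or> coprime y N)"
    then have dvd: "int p dvd x" "int p dvd y"
      by (auto simp: coprime_iff)
    have "1 \<in> (PIdl\<^bsub>R\<^esub> x) <+>\<^bsub>R\<^esub> (PIdl\<^bsub>R\<^esub> y)"
      unfolding eq carr using N1 by simp
    then obtain a b where "1 = (a * x + b * y) mod N"
      unfolding elem by blast
    \<comment> \<open>Reduction modulo \<open>N\<close> preserves divisibility by \<open>p\<close>
      because \<open>p\<close> divides \<open>N\<close>.\<close>
    moreover have "int p dvd (a * x + b * y) mod N"
      using dvd pN by (simp add: dvd_mod_iff)
    ultimately show False
      using p by simp
  qed
  with unit swap show ?thesis
    unfolding N_def[symmetric] by blast
qed

text \<open>A unit is adjacent to every other vertex and a non-unit exactly to the units, which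
  gives the degrees n - 1 and \<open>card (totatives n)\<close>. The diagonal shows \<open>n\<close>
  for a unit because the second term subtracts 1 there.\<close>

lemma laplacian_comaximal_prime_power:
  fixes p m n :: nat
  assumes p: "prime p" and m: "0 < m" and n: "n = p ^ m"
  shows "laplacian_matrix (comaximal_graph n) = mat n n (\<lambda>(i, j).
    (if i = j then real (if i \<in> totatives n then n else card (totatives n)) else 0) -
    (if i \<in> totatives n \<or> j \<in> totatives n then 1 else 0))" (is "_ = ?M")
proof -
  let ?G = "comaximal_graph n" and ?U = "totatives n"
  have n1: "n > 1"
    using one_less_power[OF prime_gt_1_nat[OF p] m] by (simp add: n)
  have U_less: "?U \<subseteq> {0..<n}"
    using totatives_less n1 by auto
  \<comment> \<open>Vertices range over 0, ..., n - 1 but totatives over 1, ..., n; for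
    \<open>n > 1\<close> neither 0 nor \<open>n\<close> is coprime to \<open>n\<close>, so the
    ranges agree on units.\<close>
  have U_iff: "coprime i n \<longleftrightarrow> i \<in> ?U" if "i < n" for i
    using that n1 by (cases "i = 0") (auto simp: in_totatives_iff)
  have verts: "pverts ?G = {0..int n - 1}"
    by (simp add: comaximal_graph_def residue_ring_def Let_def)
  then have card: "card (pverts ?G) = n"
    by simp
  have arcs: "(int i, int j) \<in> parcs ?G \<longleftrightarrow> i \<noteq> j \<and> (i \<in> ?U \<or> j \<in> ?U)" if "i < n" "j < n" for i j
    using that principal_ideals_sum_carrier_iff[OF p m, folded n, of "int i" "int j"]
    by (simp add: comaximal_graph_def Let_def U_iff) (simp add: residue_ring_def)
  have deg: "out_degree (with_proj ?G) (int i) = (if i \<in> ?U then n - 1 else card ?U)" if i: "i < n" for i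
  proof -
    have "out_arcs (with_proj ?G) (int i) = (\<lambda>j. (int i, int j)) ` {j. j < n \<and> (int i, int j) \<in> parcs ?G}"
    proof (intro equalityI subsetI)
      fix e assume "e \<in> out_arcs (with_proj ?G) (int i)"
      then obtain k where e: "e = (int i, k)" and k: "(int i, k) \<in> parcs ?G"
        by (cases e) (auto simp: out_arcs_def)
      then have "k \<in> {0..int n - 1}"
        by (auto simp: comaximal_graph_def residue_ring_def Let_def)
      then obtain j where "k = int j" "j < n"
        by (intro that[of "nat k"]) auto
      with e k show "e \<in> (\<lambda>j. (int i, int j)) ` {j. j < n \<and> (int i, int j) \<in> parcs ?G}"
        by blast
    qed (auto simp: out_arcs_def)
    then have "out_degree (with_proj ?G) (int i) = card {j. j < n \<and> (int i, int j) \<in> parcs ?G}"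
      by (simp add: out_degree_def card_image inj_on_def)
    also have "{j. j < n \<and> (int i, int j) \<in> parcs ?G} = (if i \<in> ?U then {0..<n} - {i} else ?U)"
      using i U_less arcs[OF i] by auto
    finally show ?thesis
      using i by simp
  qed
  show ?thesis
    by (rule eq_matI)
      (use n1 in \<open>auto simp: laplacian_matrix_def degree_matrix_def adjacency_matrix_def card arcs deg
        mat_diag_def of_nat_diff\<close>)
qed

section \<open>Spectrum and multiplicities\<close>

theorem theorem3p11:
  fixes p m n :: nat
  assumes "prime p" and "m > 1" and "n = p ^ m"
  defines "L \<equiv> laplacian_matrix (comaximal_graph n)"
  shows "spectrum L = {real n, real (totient n), 0} \<and>
         eigenvalue_mult L (real n) = totient n \<and>
         eigenvalue_mult L (real (totient n)) = n - totient n - 1 \<and>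
         eigenvalue_mult L 0 = 1"
proof -
  let ?U = "totatives n"
  have m0: "0 < m" and p1: "p > 1"
    using assms prime_gt_1_nat by auto
  have n1: "n > 1"
    using one_less_power[OF p1 m0] by (simp add: assms)
  have U: "?U \<subseteq> {0<..<n}"
    using totatives_less[of _ n] n1 by (auto simp: in_totatives_iff)
  have card_U: "card ?U = totient n"
    by (simp add: totient_def)
  \<comment> \<open>These strict bounds keep 0, \<open>totient n\<close> and \<open>n\<close>
    distinct, so that no two multiplicities merge.\<close>
  have tot: "0 < totient n" "totient n < n"
    using n1 totient_less by auto
  \<comment> \<open>As \<open>m > 1\<close>, \<open>p\<close> itself is a nonzero non-unit; it
    ensures that \<open>totient n\<close> really occurs as an eigenvalue.\<close>
  have p_notin: "p \<in> {0<..<n} - ?U"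
    using assms p1 m0 power_strict_increasing[of 1 m p] by (auto simp: in_totatives_iff)
  have L: "L = mat n n (\<lambda>(i, j). (if i = j then real (if i \<in> ?U then n else card ?U) else 0) -
      (if i \<in> ?U \<or> j \<in> ?U then 1 else 0))"
    unfolding L_def by (rule laplacian_comaximal_prime_power[OF assms(1) m0 assms(3)])
  have mult: "eigenvalue_mult L x =
      card {i. i < n \<and> (if i = 0 then 0 else real (if i \<in> ?U then n else card ?U)) = x}" for x
    unfolding eigenvalue_mult_def L
    by (rule order_char_poly_complete_split_laplacian[OF U]) (use n1 in simp)
  have mult_n: "eigenvalue_mult L (real n) = totient n"
  proof -
    have "{i. i < n \<and> (if i = 0 then 0 else real (if i \<in> ?U then n else card ?U)) = real n} = ?U"
      using U tot by (auto simp: card_U split: if_splits)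
    then show ?thesis by (simp add: mult card_U)
  qed
  have mult_tot: "eigenvalue_mult L (real (totient n)) = card ({0<..<n} - ?U)"
  proof -
    have "{i. i < n \<and> (if i = 0 then 0 else real (if i \<in> ?U then n else card ?U)) = real (totient n)}
        = {0<..<n} - ?U"
      using U tot by (auto simp: card_U split: if_splits)
    then show ?thesis by (simp add: mult)
  qed
  have mult_0: "eigenvalue_mult L 0 = 1"
  proof -
    have "{i. i < n \<and> (if i = 0 then 0 else real (if i \<in> ?U then n else card ?U)) = 0} = {0}"
      using tot by (auto simp: card_U split: if_splits)
    then show ?thesis by (simp add: mult)
  qed
  have mult_other: "eigenvalue_mult L x = 0" if "x \<notin> {real n, real (totient n), 0}" for x
  proof -
    have "{i. i < n \<and> (if i = 0 then 0 else real (if i \<in> ?U then n else card ?U)) = x} = {}"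
      using that by (auto simp: card_U split: if_splits)
    then show ?thesis by (simp add: mult)
  qed
  have carrier: "L \<in> carrier_mat n n"
    by (simp add: L)
  have "char_poly L \<noteq> 0"
    using degree_monic_char_poly[OF carrier] by auto
  \<comment> \<open>The roots of a nonzero polynomial are the points of nonzero order, so the
    spectrum follows from the multiplicities, including their vanishing elsewhere.\<close>
  then have spec: "x \<in> spectrum L \<longleftrightarrow> eigenvalue_mult L x \<noteq> 0" for x
    by (simp add: spectrum_def eigenvalue_root_char_poly[OF carrier] order_root eigenvalue_mult_def)
  have "card ({0<..<n} - ?U) \<noteq> 0"
    using p_notin by (metis card_0_eq empty_iff finite_Diff finite_greaterThanLessThan)
  then have "spectrum L = {real n, real (totient n), 0}"
  proof (intro equalityI subsetI)
    fix x assume "x \<in> spectrum L"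
    then have "eigenvalue_mult L x \<noteq> 0"
      unfolding spec .
    then show "x \<in> {real n, real (totient n), 0}"
      by (rule contrapos_np) (rule mult_other)
  next
    fix x assume "x \<in> {real n, real (totient n), 0}"
    then show "x \<in> spectrum L"
      using mult_n mult_tot mult_0 tot \<open>card ({0<..<n} - ?U) \<noteq> 0\<close> unfolding spec
      by (elim insertE emptyE) simp_all
  qed
  moreover have "card ({0<..<n} - ?U) = n - totient n - 1"
    using card_Diff_subset[OF finite_totatives U] by (simp add: card_U)
  ultimately show ?thesis
    using mult_n mult_tot mult_0 by simp
qed

end
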